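(* Let $k\ge 2$ and let $(M_1,\ldots,M_k)$ be an anarchy harmonious $k$-tuple. Then \[ M_1\cdots M_k<\frac{\pi^2}{6}\,2^{4^K-2\cdot 2^K}, \] where $K=\omega(M_1\cdots M_k)$.
   Context: $\sigma(n)$ denotes the sum of the positive divisors of $n$, and $\omega(n)$ the number of distinct prime factors of $n$. For an integer $k\ge2$, a tuple of distinct positive integers $(M_i)_{i=1}^k$ is called anarchy if $\gcd(M_i, M_j\sigma(M_j))=1$ for all distinct $i,j$. A tuple of positive integers $(M_i)_{i=1}^k$ is called a harmonious $k$-tuple if $\sum_{i=1}^k \frac{M_i}{\sigma(M_i)}=1$. *)

theory Defs
  imports "HOL-Analysis.Analysis" "HOL-Computational_Algebra.Computational_Algebra"
begin

text \<open>
  A tuple \<open>(M\<^sub>1, \<dots>, M\<^sub>k)\<close> is a function \<open>M :: nat \<Rightarrow> nat\<close>, of which only the values on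
  \<open>{1..k}\<close> matter.
\<close>

definition sigma :: "nat \<Rightarrow> nat" where
  "sigma n = (\<Sum>d | d dvd n. d)"

definition omega :: "nat \<Rightarrow> nat" where
  "omega n = card (prime_factors n)"

definition anarchy :: "nat \<Rightarrow> (nat \<Rightarrow> nat) \<Rightarrow> bool" where
  "anarchy k M \<longleftrightarrow>
     (\<forall>i\<in>{1..k}. M i > 0) \<and> inj_on M {1..k} \<and>
     (\<forall>i\<in>{1..k}. \<forall>j\<in>{1..k}. i \<noteq> j \<longrightarrow> gcd (M i) (M j * sigma (M j)) = 1)"

definition harmonious :: "nat \<Rightarrow> (nat \<Rightarrow> nat) \<Rightarrow> bool" where
  "harmonious k M \<longleftrightarrow>
     (\<forall>i\<in>{1..k}. M i > 0) \<and> (\<Sum>i=1..k. real (M i) / real (sigma (M i))) = 1"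

end

theory Submission
  imports Defs
begin

text \<open>
  Write \<open>x p = p ^ (e + 1)\<close> for a prime \<open>p\<close> occurring with exponent \<open>e\<close>, so that
  \<open>M\<^sub>i / \<sigma>(M\<^sub>i)\<close> is the product of \<open>(1 - 1 / p) * x p / (x p - 1)\<close> over the primes of \<open>M\<^sub>i\<close>.
  Keep only the factors \<open>1 - 1 / p\<close> with \<open>p \<in> T\<close> and \<open>x p / (x p - 1)\<close> with \<open>p \<in> S\<close>, where
  \<open>S \<subseteq> T\<close>, and let \<open>E S T\<close> be the resulting sum over \<open>i\<close>: a rational number with denominator
  \<open>D S T = (\<Prod>p\<in>T. p) * (\<Prod>p\<in>S. x p - 1)\<close>. If \<open>E S T = 1\<close>, comparing \<open>q\<close>-adic valuations for the
  largest \<open>q \<in> T - S\<close> contradicts anarchy; if \<open>S = T\<close> misses some prime, then \<open>E S T > 1\<close>.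
  Hence \<open>E S T \<noteq> 1\<close> until all primes are in \<open>S\<close>. If \<open>E S T > 1\<close>,
  then \<open>E S T \<ge> 1 + 1 / D S T\<close>, and since the missing primes bring the sum down to at most 1,
  some of them must be small and can be added to \<open>T\<close>; if \<open>E S T < 1\<close>, some missing \<open>x p\<close> must
  be small, and \<open>p\<close> can be added to \<open>S\<close>. Each step roughly squares \<open>D S T\<close>. In the end this bounds
  \<open>(\<Prod>p. x p - 1) / (\<Prod>p. p)\<close>, and \<open>M\<^sub>1 \<cdots> M\<^sub>k = (\<Prod>p. x p) / (\<Prod>p. p)\<close>
  exceeds this by a factor of at most \<open>(\<Prod>p. 1 / (1 - 1 / p\<^sup>2)) \<le> \<pi>\<^sup>2 / 6\<close>.
\<close>

subsection \<open>Small partial products\<close>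

text \<open>Abel summation: replacing all weights by the last and smallest one can only lower the
  sum, because each drop of the weight is multiplied by a nonnegative prefix sum.\<close>

lemma sum_antimono_weights_nonneg:
  fixes d g :: "nat \<Rightarrow> real"
  assumes anti: "\<And>i j. i \<le> j \<Longrightarrow> j < m \<Longrightarrow> d j \<le> d i"
    and nonneg: "\<And>j. j < m \<Longrightarrow> 0 \<le> d j"
    and prefix: "\<And>n. n \<le> m \<Longrightarrow> 0 \<le> (\<Sum>j<n. g j)"
  shows "0 \<le> (\<Sum>j<m. d j * g j)"
proof (cases m)
  case 0
  then show ?thesis by simp
next
  case (Suc m')
  have "d n * (\<Sum>j<Suc n. g j) \<le> (\<Sum>j<Suc n. d j * g j)" if "n < m" for n
    using that
  proof (induction n)
    case 0
    then show ?case by simp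
  next
    case (Suc n)
    have "d (Suc n) * (\<Sum>j<Suc n. g j) \<le> d n * (\<Sum>j<Suc n. g j)"
      using Suc.prems by (intro mult_right_mono anti prefix) auto
    also have "\<dots> \<le> (\<Sum>j<Suc n. d j * g j)"
      using Suc by simp
    finally show ?case
      by (simp add: algebra_simps)
  qed
  from this[of m'] have "d m' * (\<Sum>j<m. g j) \<le> (\<Sum>j<m. d j * g j)"
    using Suc by simp
  moreover have "0 \<le> d m' * (\<Sum>j<m. g j)"
    by (intro mult_nonneg_nonneg nonneg prefix) (simp_all add: Suc)
  ultimately show ?thesis by linarith
qed

text \<open>A weighted majorization argument. \<open>tangent\<close> is the supporting-line
  inequality for \<open>ln F\<close> as a concave function of \<open>ln x\<close>, with slope
  \<open>h x\<close>. If no \<open>V\<close> worked, the prefix products of the sorted values of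
  \<open>f\<close> would dominate those of \<open>z\<close>; weighting the differences of logarithms
  by \<open>h\<close> and summing would contradict \<open>less\<close>.\<close>

lemma exists_subset_prod_less:
  fixes F h :: "real \<Rightarrow> real" and f :: "'a \<Rightarrow> real" and z :: "nat \<Rightarrow> real"
  assumes fin: "finite W"
    and A: "\<And>w. w \<in> W \<Longrightarrow> f w \<in> A" "\<And>j. z j \<in> A" "A \<subseteq> {0<..}"
    and Fpos: "\<And>x. x \<in> A \<Longrightarrow> 0 < F x"
    and hpos: "\<And>x. x \<in> A \<Longrightarrow> 0 \<le> h x"
    and hanti: "\<And>x y. x \<in> A \<Longrightarrow> y \<in> A \<Longrightarrow> x \<le> y \<Longrightarrow> h y \<le> h x"
    and tangent: "\<And>x y. x \<in> A \<Longrightarrow> y \<in> A \<Longrightarrow> h x * (ln x - ln y) \<le> ln (F x) - ln (F y)"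
    and less: "(\<Prod>w\<in>W. F (f w)) < (\<Prod>j<card W. F (z j))"
  shows "\<exists>V\<subseteq>W. V \<noteq> {} \<and> (\<Prod>w\<in>V. f w) < (\<Prod>j<card V. z j)"
proof (rule ccontr)
  assume "\<not> ?thesis"
  then have ge: "(\<Prod>j<card V. z j) \<le> (\<Prod>w\<in>V. f w)" if "V \<subseteq> W" "V \<noteq> {}" for V
    using that by (meson not_le)
  obtain ws0 where "set ws0 = W" "distinct ws0"
    using finite_distinct_list[OF fin] by blast
  \<comment> \<open>Increasing order makes the weights \<open>h (x j)\<close> nonincreasing, and the
    first \<open>n\<close> elements form a subset to which \<open>ge\<close> applies.\<close>
  define ws where "ws = sort_key f ws0"
  have ws: "set ws = W" "distinct ws" "sorted (map f ws)"
    using \<open>set ws0 = W\<close> \<open>distinct ws0\<close> by (auto simp: ws_def)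
  define x where "x j = f (ws ! j)" for j
  have len: "length ws = card W"
    using distinct_card[OF ws(2)] ws(1) by simp
  have xA: "x j \<in> A" if "j < card W" for j
    using that len ws A(1) unfolding x_def by auto
  have prod_take: "(\<Prod>w\<in>set (take n ws). G (f w)) = (\<Prod>j<n. G (x j))"
    "card (set (take n ws)) = n" if "n \<le> card W" for n and G :: "real \<Rightarrow> real"
  proof -
    have "bij_betw ((!) ws) {..<n} (set (take n ws))"
      using that len ws by (intro bij_betw_imageI) (auto simp: inj_on_def nth_eq_iff_index_eq
          nth_image[symmetric] lessThan_atLeast0)
    then show "(\<Prod>w\<in>set (take n ws). G (f w)) = (\<Prod>j<n. G (x j))"
      and "card (set (take n ws)) = n"
      by (auto simp: x_def prod.reindex_bij_betw[symmetric] dest: bij_betw_same_card)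
  qed
  have zpos: "0 < z j" for j using A by auto
  have xpos: "0 < x j" if "j < card W" for j using A xA[OF that] by auto
  have Fx: "0 < F (x j)" if "j < card W" for j using Fpos xA that by auto
  have Fz: "0 < F (z j)" for j using Fpos A by auto
  have "0 \<le> (\<Sum>j<card W. h (x j) * (ln (x j) - ln (z j)))"
  proof (rule sum_antimono_weights_nonneg)
    show "h (x j) \<le> h (x i)" if "i \<le> j" "j < card W" for i j
    proof -
      have "map f ws ! i \<le> map f ws ! j"
        using that len ws by (intro sorted_nth_mono) auto
      then have "x i \<le> x j"
        using that len by (simp add: x_def)
      with that show ?thesis by (intro hanti xA) auto
    qed
    show "0 \<le> h (x j)" if "j < card W" for j
      using that hpos xA by auto
    show "0 \<le> (\<Sum>j<n. ln (x j) - ln (z j))" if "n \<le> card W" for n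
    proof (cases "n = 0")
      case False
      have "set (take n ws) \<subseteq> W" "set (take n ws) \<noteq> {}"
        using set_take_subset[of n ws] ws(1) prod_take(2)[OF that] False by auto
      from ge[OF this] have "(\<Prod>j<n. z j) \<le> (\<Prod>j<n. x j)"
        by (simp only: prod_take(1)[OF that, of "\<lambda>t. t"] prod_take(2)[OF that])
      moreover have "0 < (\<Prod>j<n. z j)" "0 < (\<Prod>j<n. x j)"
        using zpos xpos that by (auto intro!: prod_pos)
      ultimately have "ln (\<Prod>j<n. z j) \<le> ln (\<Prod>j<n. x j)"
        by simp
      also have "ln (\<Prod>j<n. z j) = (\<Sum>j<n. ln (z j))"
        by (intro ln_prod) (auto simp: zpos[THEN less_imp_neq, THEN not_sym])
      also have "ln (\<Prod>j<n. x j) = (\<Sum>j<n. ln (x j))"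
        using that by (intro ln_prod) (auto intro!: less_imp_neq[symmetric] xpos)
      finally show ?thesis by (simp add: sum_subtractf)
    qed simp
  qed
  also have "\<dots> \<le> (\<Sum>j<card W. ln (F (x j)) - ln (F (z j)))"
    using xA A by (intro sum_mono tangent) auto
  also have "\<dots> = ln (\<Prod>j<card W. F (x j)) - ln (\<Prod>j<card W. F (z j))"
    by (subst (1 2) ln_prod)
       (auto simp: sum_subtractf Fx[THEN less_imp_neq, THEN not_sym] Fz[THEN less_imp_neq, THEN not_sym])
  finally have "(\<Prod>j<card W. F (z j)) \<le> (\<Prod>j<card W. F (x j))"
    by (subst (asm) diff_ge_0_iff_ge, subst (asm) ln_le_cancel_iff)
       (auto intro!: prod_pos Fx Fz)
  moreover have "(\<Prod>j<card W. F (x j)) = (\<Prod>w\<in>W. F (f w))"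
    using prod_take(1)[of "card W" F] ws len by simp
  ultimately show False using less by linarith
qed

lemma prod_power_two_power:
  fixes y :: "'a :: comm_semiring_1"
  shows "(\<Prod>j<n. y ^ 2 ^ j) = y ^ (2 ^ n - 1)"
proof (induction n)
  case (Suc n)
  have "2 ^ n - 1 + 2 ^ n = 2 ^ Suc n - (1 :: nat)"
    using one_le_power[of "2::nat" n] by (simp del: one_le_power)
  with Suc show ?case by (simp flip: power_add)
qed simp

text \<open>The extremal values \<open>y ^ 2 ^ j\<close> of \<open>f\<close> come from the telescoping product
  \<open>(1 + y) * (1 + y ^ 2) * (1 + y ^ 4) * \<dots>\<close>.\<close>

lemma exists_subset_prod_less_succ:
  fixes f :: "'a \<Rightarrow> real" and y :: real
  assumes "finite W" "1 < y" "\<And>w. w \<in> W \<Longrightarrow> 0 < f w"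
    and "(\<Prod>w\<in>W. f w / (f w + 1)) \<le> 1 - 1 / y"
  shows "\<exists>V\<subseteq>W. V \<noteq> {} \<and> (\<Prod>w\<in>V. f w) < y ^ (2 ^ card V - 1)"
proof -
  have tele: "(\<Prod>j<n. y ^ 2 ^ j / (y ^ 2 ^ j + 1)) * (1 - 1 / y ^ 2 ^ n) = 1 - 1 / y" for n
  proof (induction n)
    case (Suc n)
    define d where "d = y ^ 2 ^ n"
    have "0 < d" using assms by (simp add: d_def)
    have sq: "y ^ 2 ^ Suc n = d\<^sup>2" by (simp add: d_def power_mult[symmetric] mult.commute)
    have "d / (d + 1) * (1 - 1 / d\<^sup>2) = 1 - 1 / d"
      using \<open>0 < d\<close> by (simp add: divide_simps power2_eq_square) (simp add: algebra_simps)
    then have "(\<Prod>j<Suc n. y ^ 2 ^ j / (y ^ 2 ^ j + 1)) * (1 - 1 / y ^ 2 ^ Suc n)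
        = (\<Prod>j<n. y ^ 2 ^ j / (y ^ 2 ^ j + 1)) * (1 - 1 / d)"
      by (simp only: prod.lessThan_Suc sq d_def[symmetric] mult.assoc)
    with Suc show ?case by (simp add: d_def)
  qed simp
  \<comment> \<open>The cofactor in \<open>tele\<close> is below 1, so every finite product stays
    strictly above the limit.\<close>
  have "1 - 1 / y < (\<Prod>j<n. y ^ 2 ^ j / (y ^ 2 ^ j + 1))" for n
  proof -
    have "0 < (\<Prod>j<n. y ^ 2 ^ j / (y ^ 2 ^ j + 1))"
      using assms by (intro prod_pos) (auto intro!: divide_pos_pos add_pos_pos)
    moreover have "0 < 1 / y ^ 2 ^ n" using assms by simp
    ultimately show ?thesis
      by (subst tele[of n, symmetric]) (simp add: algebra_simps)
  qed
  with assms have "(\<Prod>w\<in>W. f w / (f w + 1)) < (\<Prod>j<card W. y ^ 2 ^ j / (y ^ 2 ^ j + 1))"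
    by (meson le_less_trans)
  then have "\<exists>V\<subseteq>W. V \<noteq> {} \<and> (\<Prod>w\<in>V. f w) < (\<Prod>j<card V. y ^ 2 ^ j)"
  proof (rule exists_subset_prod_less[where A = "{0<..}" and h = "\<lambda>x. 1 / (x + 1)" and
        F = "\<lambda>x. x / (x + 1)", rotated -1])
    fix x z :: real
    assume "x \<in> {0<..}" "z \<in> {0<..}"
    then have pos: "0 < x" "0 < z" by auto
    \<comment> \<open>Concavity of \<open>ln\<close> at the points \<open>z / x\<close> and
      \<open>1\<close> with weights \<open>x / (x + 1)\<close> and \<open>1 / (x + 1)\<close>,
      chosen so that the mean is \<open>(z + 1) / (x + 1)\<close>.\<close>
    have "(1 - 1 / (x + 1)) * ln (z / x) + 1 / (x + 1) * ln 1
        \<le> ln ((1 - 1 / (x + 1)) *\<^sub>R (z / x) + (1 / (x + 1)) *\<^sub>R 1)"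
      using pos by (intro concave_onD[OF ln_concave]) auto
    also have "(1 - 1 / (x + 1)) *\<^sub>R (z / x) + (1 / (x + 1)) *\<^sub>R 1 = (z + 1) / (x + 1)"
      using pos by (simp add: field_simps)
    finally show "1 / (x + 1) * (ln x - ln z) \<le> ln (x / (x + 1)) - ln (z / (z + 1))"
      using pos by (simp add: ln_div algebra_simps diff_divide_distrib)
    show "x \<le> z \<Longrightarrow> 1 / (z + 1) \<le> 1 / (x + 1)"
      using pos by (intro divide_left_mono) auto
  qed (use assms(1-3) in auto)
  then show ?thesis by (simp add: prod_power_two_power)
qed

text \<open>The extremal values of \<open>f\<close> are \<open>y\<^sup>2 / (y - 1), y\<^sup>2, y ^ 4, y ^ 8, \<dots>\<close>, whose partial products are
  \<open>y ^ 2 ^ n / (y - 1)\<close>.\<close>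

lemma exists_subset_prod_less_mult:
  fixes f :: "'a \<Rightarrow> real" and y :: real
  assumes "finite W" "2 \<le> y" "\<And>w. w \<in> W \<Longrightarrow> 1 < f w"
    and "(\<Prod>w\<in>W. 1 - 1 / f w) \<le> 1 - 1 / y"
  shows "\<exists>V\<subseteq>W. V \<noteq> {} \<and> (y - 1) * (\<Prod>w\<in>V. f w) < y ^ 2 ^ card V"
proof -
  define z where "z j = (if j = 0 then y\<^sup>2 / (y - 1) else y ^ 2 ^ j)" for j :: nat
  have prod_z: "(y - 1) * (\<Prod>j<Suc n. z j) = y ^ 2 ^ Suc n" for n
  proof (induction n)
    case 0
    then show ?case using assms by (simp add: z_def)
  next
    case (Suc n)
    have "(y - 1) * (\<Prod>j<Suc (Suc n). z j) = (y - 1) * (\<Prod>j<Suc n. z j) * z (Suc n)"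
      by (simp only: prod.lessThan_Suc mult.assoc)
    also have "\<dots> = y ^ 2 ^ Suc n * y ^ 2 ^ Suc n"
      by (simp only: Suc) (simp add: z_def)
    also have "\<dots> = y ^ 2 ^ Suc (Suc n)"
      by (simp flip: power_add)
    finally show ?case .
  qed
  \<comment> \<open>The base case is an equality. Multiplying by \<open>1 - d\<close> preserves the
    bound once \<open>2 * d \<le> 1 / y\<close>, which follows from \<open>d \<le> 1 / y ^ 2\<close>
    and \<open>2 \<le> y\<close>.\<close>
  have prod_F: "1 - 1 / y + 1 / y ^ 2 ^ Suc n \<le> (\<Prod>j<Suc n. 1 - 1 / z j)" for n
  proof (induction n)
    case 0
    then show ?case using assms by (simp add: z_def field_simps power2_eq_square)
  next
    case (Suc n)
    define d where "d = 1 / y ^ 2 ^ Suc n"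
    have "y\<^sup>2 \<le> y ^ 2 ^ Suc n"
      using assms by (intro power_increasing) auto
    with assms have dy: "0 < d" "d \<le> 1 / y\<^sup>2"
      by (auto simp: d_def intro!: divide_left_mono)
    have "2 * d \<le> 2 * (1 / y\<^sup>2)" using dy by simp
    also have "\<dots> \<le> 1 / y" using assms by (simp add: field_simps power2_eq_square)
    finally have "d * (2 * d) \<le> d * (1 / y)" using dy by (intro mult_left_mono) auto
    moreover have "(1 - 1 / y + d) * (1 - d) = 1 - 1 / y + d * (1 / y) - d * d"
      by (simp add: ring_distribs)
    ultimately have "1 - 1 / y + d\<^sup>2 \<le> (1 - 1 / y + d) * (1 - d)"
      by (simp add: power2_eq_square)
    also have "\<dots> \<le> (\<Prod>j<Suc n. 1 - 1 / z j) * (1 - d)"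
    proof (rule mult_right_mono)
      show "1 - 1 / y + d \<le> (\<Prod>j<Suc n. 1 - 1 / z j)"
        using Suc unfolding d_def .
      have "1 / y\<^sup>2 \<le> 1" using assms by (simp add: field_simps)
      with dy show "0 \<le> 1 - d" by linarith
    qed
    also have "1 - d = 1 - 1 / z (Suc n)" by (simp add: d_def z_def)
    finally have "1 - 1 / y + d\<^sup>2 \<le> (\<Prod>j<Suc (Suc n). 1 - 1 / z j)"
      by simp
    moreover have "d\<^sup>2 = 1 / y ^ 2 ^ Suc (Suc n)"
      by (simp add: d_def power_one_over mult.commute flip: power_mult)
    ultimately show ?case by simp
  qed
  have less: "1 - 1 / y < (\<Prod>j<n. 1 - 1 / z j)" for n
  proof (cases n)
    case 0
    then show ?thesis using assms by simp
  next
    case (Suc n')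
    have "0 < 1 / y ^ 2 ^ Suc n'" using assms by simp
    with prod_F[of n'] show ?thesis unfolding Suc by linarith
  qed
  have z1: "1 < z j" for j
  proof -
    have "y - 1 < y * y" using mult_left_mono[of 2 y y] assms by linarith
    then have "1 < y\<^sup>2 / (y - 1)"
      using assms by (subst less_divide_eq_1_pos) (auto simp: power2_eq_square)
    then show ?thesis using assms by (simp add: z_def)
  qed
  from less assms have "(\<Prod>w\<in>W. 1 - 1 / f w) < (\<Prod>j<card W. 1 - 1 / z j)"
    by (meson le_less_trans)
  then have "\<exists>V\<subseteq>W. V \<noteq> {} \<and> (\<Prod>w\<in>V. f w) < (\<Prod>j<card V. z j)"
  proof (rule exists_subset_prod_less[where A = "{1<..}" and h = "\<lambda>x. 1 / (x - 1)" and
        F = "\<lambda>x. 1 - 1 / x", rotated -1])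
    fix u v :: real
    assume "u \<in> {1<..}" "v \<in> {1<..}"
    then have pos: "1 < u" "1 < v" by auto
    \<comment> \<open>The tangent inequality comes from \<open>ln t \<le> t - 1\<close>, used at
      \<open>t = (1 - 1 / v) / (1 - 1 / u)\<close> and at \<open>t = u / v\<close>.\<close>
    have "ln (1 - 1 / v) - ln (1 - 1 / u) = ln ((1 - 1 / v) / (1 - 1 / u))"
      using pos by (subst ln_div) auto
    also have "\<dots> \<le> (1 - 1 / v) / (1 - 1 / u) - 1"
      using pos by (intro ln_le_minus_one) auto
    also have "\<dots> = 1 / (u - 1) * (1 - u / v)"
      using pos by (simp add: field_simps)
    also have "\<dots> \<le> 1 / (u - 1) * (- ln (u / v))"
      using pos ln_le_minus_one[of "u / v"] by (intro mult_left_mono) auto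
    also have "\<dots> = 1 / (u - 1) * (ln v - ln u)"
      using pos by (simp add: ln_div)
    finally show "1 / (u - 1) * (ln u - ln v) \<le> ln (1 - 1 / u) - ln (1 - 1 / v)"
      by (simp add: right_diff_distrib)
    show "u \<le> v \<Longrightarrow> 1 / (v - 1) \<le> 1 / (u - 1)"
      using pos by (intro divide_left_mono) auto
  qed (use assms(1,3) z1 in auto)
  then obtain V where V: "V \<subseteq> W" "V \<noteq> {}" "(\<Prod>w\<in>V. f w) < (\<Prod>j<card V. z j)"
    by blast
  then obtain n where n: "card V = Suc n"
    using \<open>finite W\<close> by (metis card_eq_0_iff finite_subset not0_implies_Suc)
  have "(y - 1) * (\<Prod>w\<in>V. f w) < (y - 1) * (\<Prod>j<card V. z j)"
    using V assms by (intro mult_strict_left_mono) auto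
  also have "\<dots> = y ^ 2 ^ card V"
    by (simp only: n prod_z)
  finally show ?thesis using V(1,2) by blast
qed

subsection \<open>Euler products and divisor sums\<close>

text \<open>A sieve: removing the multiples of the primes in \<open>P\<close> from the sum of
  \<open>1 / n ^ 2\<close> multiplies \<open>pi ^ 2 / 6\<close> by exactly this product, and the
  surviving term \<open>n = 1\<close> alone contributes 1.\<close>

lemma prod_one_minus_inverse_squares_ge:
  assumes "finite P" "\<And>p. p \<in> P \<Longrightarrow> prime p"
  shows "6 / pi\<^sup>2 \<le> (\<Prod>p\<in>P. 1 - 1 / (real p)\<^sup>2)"
proof -
  define f where "f n = 1 / (real n)\<^sup>2" for n :: nat
  define A where "A P = {n. 0 < n \<and> (\<forall>p\<in>P. \<not> p dvd n)}" for P :: "nat set"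
  have "(\<lambda>n. f (Suc n)) sums (pi\<^sup>2 / 6)"
    using inverse_squares_sums by (simp add: f_def add_ac)
  then have "((\<lambda>n. f (Suc n)) has_sum (pi\<^sup>2 / 6)) UNIV"
    by (intro norm_summable_imp_has_sum) (auto simp: f_def sums_iff)
  then have "(f has_sum (pi\<^sup>2 / 6)) (range Suc)"
    by (subst has_sum_reindex) (auto simp: o_def)
  moreover have "range Suc = A {}"
    by (auto simp: A_def image_iff gr0_conv_Suc)
  ultimately have zeta: "(f has_sum (pi\<^sup>2 / 6)) (A {})"
    by simp
  have summable: "f summable_on A Q" for Q
    by (rule summable_on_subset_banach[OF has_sum_imp_summable[OF zeta]]) (auto simp: A_def)
  have "infsum f (A P) = (\<Prod>p\<in>P. 1 - 1 / (real p)\<^sup>2) * (pi\<^sup>2 / 6)"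
    using assms
  proof (induction P rule: finite_induct)
    case empty
    then show ?case using infsumI[OF zeta] by simp
  next
    case (insert p P)
    have "p > 0" using insert.prems by (simp add: prime_gt_0_nat)
    \<comment> \<open>As \<open>p\<close> lies outside \<open>P\<close>, membership in
      \<open>A P\<close> is insensitive to factors \<open>p\<close>; so the multiples of
      \<open>p\<close> in \<open>A P\<close> are a scaled copy of \<open>A P\<close> itself.\<close>
    have split: "A P = A (insert p P) \<union> (*) p ` A P"
    proof (intro equalityI subsetI)
      fix n assume n: "n \<in> A P"
      show "n \<in> A (insert p P) \<union> (*) p ` A P"
      proof (cases "p dvd n")
        case True
        then obtain m where "n = p * m" by blast
        with n have "m \<in> A P" by (auto simp: A_def)
        with \<open>n = p * m\<close> show ?thesis by blast
      qed (use n in \<open>auto simp: A_def\<close>)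
    next
      fix n assume "n \<in> A (insert p P) \<union> (*) p ` A P"
      then show "n \<in> A P"
      proof
        assume "n \<in> (*) p ` A P"
        then obtain m where m: "n = p * m" "m \<in> A P" by blast
        have "prime p" using insert.prems by simp
        have "\<not> q dvd p * m" if "q \<in> P" for q
          using that m insert.prems insert.hyps \<open>prime p\<close> primes_dvd_imp_eq[of q p]
          by (auto simp: A_def prime_dvd_mult_iff)
        with m \<open>p > 0\<close> show ?thesis by (auto simp: A_def)
      qed (auto simp: A_def)
    qed
    have "infsum f (A P) = infsum f (A (insert p P)) + infsum f ((*) p ` A P)"
    proof (subst split, rule infsum_Un_disjoint)
      show "f summable_on (*) p ` A P"
        using split by (intro summable_on_subset_banach[OF summable[of P]]) blast
    qed (rule summable, auto simp: A_def)
    also have "infsum f ((*) p ` A P) = infsum (\<lambda>n. 1 / (real p)\<^sup>2 * f n) (A P)"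
      using \<open>p > 0\<close> by (subst infsum_reindex) (simp_all add: inj_on_def f_def o_def power_mult_distrib)
    also have "\<dots> = 1 / (real p)\<^sup>2 * infsum f (A P)"
      by (rule infsum_cmult_right')
    finally have "infsum f (A (insert p P)) = (1 - 1 / (real p)\<^sup>2) * infsum f (A P)"
      unfolding left_diff_distrib by linarith
    with insert show ?case by simp
  qed
  moreover have "1 \<le> infsum f (A P)"
  proof -
    have "1 \<notin> P" using assms(2) not_prime_1 by blast
    then have "1 \<in> A P" by (auto simp: A_def)
    then have "infsum f {1} \<le> infsum f (A P)"
      by (intro infsum_mono2 summable) (auto simp: f_def)
    then show ?thesis by (simp add: f_def)
  qed
  ultimately show ?thesis by (simp add: field_simps)
qed

section \<open>The divisor sum as a product over primes\<close>

lemma sigma_mult_coprime: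
  assumes "coprime a b" "a > 0" "b > 0"
  shows "sigma (a * b) = sigma a * sigma b"
proof -
  have "bij_betw (\<lambda>(d, e). d * e) ({d. d dvd a} \<times> {e. e dvd b}) {d. d dvd a * b}"
  proof (rule bij_betw_imageI)
    \<comment> \<open>Applied in both directions, this recovers the first factor of a pair from the
      product.\<close>
    have dvd: "d dvd d'" if "d * e = d' * e'" "d dvd a" "e' dvd b" for d e d' e'
    proof -
      have "coprime d e'" using assms(1) that(2,3) by (meson coprime_divisors)
      moreover have "d dvd d' * e'" using that(1) by (metis dvd_triv_left)
      ultimately show ?thesis by (simp add: coprime_dvd_mult_left_iff)
    qed
    show "inj_on (\<lambda>(d, e). d * e) ({d. d dvd a} \<times> {e. e dvd b})"
    proof (rule inj_onI, clarsimp)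
      fix d e d' e' assume *: "d dvd a" "e dvd b" "d' dvd a" "e' dvd b" "d * e = d' * e'"
      then have "d = d'" using dvd[of d e d' e'] dvd[of d' e' d e] by (auto intro: dvd_antisym)
      moreover have "d' > 0" using * assms by (auto intro: dvd_pos_nat)
      ultimately show "d = d' \<and> e = e'" using * by simp
    qed
    show "(\<lambda>(d, e). d * e) ` ({d. d dvd a} \<times> {e. e dvd b}) = {d. d dvd a * b}"
      by (force simp: mult_dvd_mono dest: division_decomp)
  qed
  then have "sigma (a * b) = (\<Sum>(d, e)\<in>{d. d dvd a} \<times> {e. e dvd b}. d * e)"
    unfolding sigma_def by (subst sum.reindex_bij_betw[symmetric]) (auto simp: case_prod_unfold)
  then show ?thesis by (simp add: sigma_def sum_product sum.cartesian_product)
qed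

lemma sigma_prime_power:
  assumes "prime p"
  shows "sigma (p ^ e) = (\<Sum>l\<le>e. p ^ l)"
proof -
  have "{d. d dvd p ^ e} = (\<lambda>l. p ^ l) ` {..e}"
    using assms by (auto simp: divides_primepow_nat)
  moreover have "inj_on (\<lambda>l. p ^ l) {..e}"
    using prime_gt_1_nat[OF assms] by (auto simp: inj_on_def)
  ultimately show ?thesis by (simp add: sigma_def sum.reindex)
qed

lemma sigma_prod_prime_powers:
  assumes "finite A" "\<And>p. p \<in> A \<Longrightarrow> prime p"
  shows "sigma (\<Prod>p\<in>A. p ^ e p) = (\<Prod>p\<in>A. \<Sum>l\<le>e p. p ^ l)"
  using assms
proof (induction A rule: finite_induct)
  case empty
  then show ?case by (simp add: sigma_def)
next
  case (insert p A)
  have "coprime (p ^ e p) (\<Prod>q\<in>A. q ^ e q)"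
    using insert by (intro prod_coprime_right) (auto intro!: primes_coprime)
  with insert show ?case
    by (auto simp: sigma_mult_coprime sigma_prime_power prime_gt_0_nat intro!: prod_pos)
qed

lemma sigma_eq_prod:
  assumes "n > 0"
  shows "sigma n = (\<Prod>p\<in>prime_factors n. \<Sum>l\<le>multiplicity p n. p ^ l)"
  using sigma_prod_prime_powers[of "prime_factors n" "\<lambda>p. multiplicity p n"] assms
  by (auto simp: prime_factorization_nat[symmetric])

text \<open>Separates the contribution of a prime power to \<open>n / sigma n\<close> into a factor
  depending on \<open>p\<close> and one depending on \<open>p ^ Suc e\<close>, so that the two can
  be introduced at different times.\<close>

lemma power_over_geometric_sum:
  fixes p :: "'a :: field"
  assumes "p \<noteq> 0" "p \<noteq> 1"
  shows "p ^ e / (\<Sum>l\<le>e. p ^ l) = (1 - 1 / p) * (p ^ Suc e / (p ^ Suc e - 1))"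
proof -
  have geo: "p ^ Suc e - 1 = (p - 1) * (\<Sum>l\<le>e. p ^ l)"
    by (simp add: power_diff_1_eq lessThan_Suc_atMost del: power_Suc)
  have "(1 - 1 / p) * p ^ Suc e = (p - 1) * p ^ e"
    using assms by (simp add: algebra_simps)
  then have "(1 - 1 / p) * (p ^ Suc e / (p ^ Suc e - 1))
      = ((p - 1) * p ^ e) / ((p - 1) * (\<Sum>l\<le>e. p ^ l))"
    by (simp only: geo times_divide_eq_right)
  with assms show ?thesis by simp
qed

subsection \<open>Balanced products\<close>

text \<open>Intersecting with \<open>B i\<close> lets one pair of sets \<open>S\<close>,
  \<open>T\<close> govern all summands at once. It stands outside the locale below because the
  locale assumptions mention it.\<close>

definition partial_value ::
  "(nat \<Rightarrow> nat) \<Rightarrow> 'i set \<Rightarrow> ('i \<Rightarrow> nat set) \<Rightarrow> nat set \<Rightarrow> nat set \<Rightarrow> real" where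
  "partial_value x I B S T =
     (\<Sum>i\<in>I. (\<Prod>p\<in>T \<inter> B i. 1 - 1 / real p) * (\<Prod>p\<in>S \<inter> B i. real (x p) / (real (x p) - 1)))"

text \<open>Isolates the size argument from number theory: the divisibility properties of the tuple
  enter only through \<open>unbalanced\<close>, and harmony only through
  \<open>balanced\<close>.\<close>

locale balanced_products =
  fixes P :: "nat set" and x :: "nat \<Rightarrow> nat" and I :: "'i set" and B :: "'i \<Rightarrow> nat set"
  assumes finite_P: "finite P"
    and ge_2: "p \<in> P \<Longrightarrow> 2 \<le> p"
    and x_gt: "p \<in> P \<Longrightarrow> p < x p"
    and balanced: "partial_value x I B P P = 1"
    and finite_I: "finite I"
    and covered: "P \<subseteq> (\<Union>i\<in>I. B i)"
    and unbalanced: "S \<subset> T \<Longrightarrow> T \<subseteq> P \<Longrightarrow> partial_value x I B S T \<noteq> 1"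
begin

abbreviation "E \<equiv> partial_value x I B"

definition D :: "nat set \<Rightarrow> nat set \<Rightarrow> nat" where
  "D S T = (\<Prod>p\<in>T. p) * (\<Prod>p\<in>S. x p - 1)"

lemma finite_sub: "S \<subseteq> P \<Longrightarrow> finite S"
  using finite_P finite_subset by blast

definition u :: "nat \<Rightarrow> real" where "u p = 1 - 1 / real p"

definition v :: "nat \<Rightarrow> real" where "v p = real (x p) / (real (x p) - 1)"

lemma E_eq: "E S T = (\<Sum>i\<in>I. prod u (T \<inter> B i) * prod v (S \<inter> B i))"
  by (simp add: partial_value_def u_def v_def)

lemma u_pos: "p \<in> P \<Longrightarrow> 0 < u p" and u_le_1: "p \<in> P \<Longrightarrow> u p \<le> 1"
  using ge_2[of p] by (auto simp: u_def)

lemma v_gt_1: "p \<in> P \<Longrightarrow> 1 < v p"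
  using ge_2[of p] x_gt[of p] by (auto simp: v_def)

lemma v_inverse_le_1: "p \<in> P \<Longrightarrow> inverse (v p) \<le> 1"
  using v_gt_1[of p] by (simp add: inverse_le_1_iff)

lemma v_pos: "p \<in> P \<Longrightarrow> 0 < v p"
  using v_gt_1[of p] by linarith

text \<open>After clearing denominators this is \<open>p < x p\<close>. A prime entered with both of
  its factors thus lowers the summands containing it.\<close>

lemma uv_less_1:
  assumes "p \<in> P"
  shows "u p * v p < 1"
proof -
  have "0 < real p" "0 < real (x p) - 1" "real p < real (x p)"
    using ge_2[OF assms] x_gt[OF assms] by auto
  then show ?thesis by (simp add: u_def v_def field_simps)
qed

lemma x_pred: "p \<in> P \<Longrightarrow> real (x p - 1) = real (x p) - 1" "p \<in> P \<Longrightarrow> 0 < x p - 1"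
  using ge_2[of p] x_gt[of p] by auto

lemma prod_u_pos: "S \<subseteq> P \<Longrightarrow> 0 < prod u S"
  using u_pos by (auto intro!: prod_pos)

lemma prod_v_pos: "S \<subseteq> P \<Longrightarrow> 0 < prod v S"
  using v_pos by (auto intro!: prod_pos)

lemma prod_u_Int_nonneg: "S \<subseteq> P \<Longrightarrow> 0 \<le> prod u (S \<inter> A)"
  and prod_v_Int_nonneg: "S \<subseteq> P \<Longrightarrow> 0 \<le> prod v (S \<inter> A)"
  using prod_u_pos[of "S \<inter> A"] prod_v_pos[of "S \<inter> A"] by (auto intro: less_imp_le)

lemma D_pos:
  assumes "S \<subseteq> P" "T \<subseteq> P"
  shows "0 < D S T"
proof -
  have "0 < p" if "p \<in> T" for p
    using that assms(2) ge_2[of p] by auto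
  moreover have "0 < x p - 1" if "p \<in> S" for p
    using that assms(1) x_pred(2)[of p] by blast
  ultimately show ?thesis
    unfolding D_def by (intro mult_pos_pos prod_pos) blast+
qed

lemma D_Un_right:
  assumes "T \<subseteq> P" "W \<subseteq> P - T"
  shows "D S (T \<union> W) = D S T * (\<Prod>p\<in>W. p)"
proof -
  have "(\<Prod>p\<in>T \<union> W. p) = (\<Prod>p\<in>T. p) * (\<Prod>p\<in>W. p)"
    using assms by (intro prod.union_disjoint finite_sub) auto
  then show ?thesis by (simp add: D_def)
qed

lemma D_Un_left:
  assumes "S \<subseteq> P" "W \<subseteq> P - S"
  shows "D (S \<union> W) T = D S T * (\<Prod>p\<in>W. x p - 1)"
proof -
  have "(\<Prod>p\<in>S \<union> W. x p - 1) = (\<Prod>p\<in>S. x p - 1) * (\<Prod>p\<in>W. x p - 1)"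
    using assms by (intro prod.union_disjoint finite_sub) auto
  then show ?thesis by (simp add: D_def)
qed

section \<open>How the partial value moves when the sets grow\<close>

lemma prod_Un_Int:
  fixes f :: "nat \<Rightarrow> 'c :: comm_monoid_mult"
  assumes "S \<subseteq> P" "W \<subseteq> P - S"
  shows "prod f ((S \<union> W) \<inter> A) = prod f (S \<inter> A) * prod f (W \<inter> A)"
  unfolding Int_Un_distrib2 using assms by (intro prod.union_disjoint finite_sub) auto

lemma prod_le_prod_Int:
  fixes f :: "nat \<Rightarrow> real"
  assumes "W \<subseteq> P" "\<And>p. p \<in> P \<Longrightarrow> 0 \<le> f p" "\<And>p. p \<in> P \<Longrightarrow> f p \<le> 1"
  shows "prod f W \<le> prod f (W \<inter> A)"
proof -
  have "prod f W = prod f (W \<inter> A) * prod f (W - A)"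
    using assms(1) by (intro prod.Int_Diff finite_sub) auto
  also have "\<dots> \<le> prod f (W \<inter> A) * 1"
    using assms by (intro mult_left_mono prod_le_1 prod_nonneg) auto
  finally show ?thesis by simp
qed

text \<open>Summand \<open>i\<close> only acquires the factors \<open>u p\<close> with
  \<open>p\<close> in \<open>B i\<close>. All \<open>u p\<close> are at most 1, so charging the
  whole of \<open>W\<close> to every summand gives a lower bound.\<close>

lemma E_Un_right:
  assumes "S \<subseteq> P" "T \<subseteq> P" "W \<subseteq> P - T"
  shows "E S T * prod u W \<le> E S (T \<union> W)"
  unfolding E_eq sum_distrib_right
proof (rule sum_mono)
  fix i
  have "W \<subseteq> P" using assms by auto
  then have "prod u W \<le> prod u (W \<inter> B i)"
    using u_pos u_le_1 by (intro prod_le_prod_Int) (auto intro: less_imp_le)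
  moreover have "0 \<le> prod u (T \<inter> B i) * prod v (S \<inter> B i)"
    using assms by (simp add: prod_u_Int_nonneg prod_v_Int_nonneg)
  ultimately have "prod u (T \<inter> B i) * prod v (S \<inter> B i) * prod u W
      \<le> prod u (T \<inter> B i) * prod v (S \<inter> B i) * prod u (W \<inter> B i)"
    by (rule mult_left_mono)
  also have "\<dots> = prod u ((T \<union> W) \<inter> B i) * prod v (S \<inter> B i)"
    using assms by (simp add: prod_Un_Int)
  finally show "prod u (T \<inter> B i) * prod v (S \<inter> B i) * prod u W
      \<le> prod u ((T \<union> W) \<inter> B i) * prod v (S \<inter> B i)" .
qed

text \<open>Counterpart of \<open>E_Un_right\<close> for factors above 1. The form with inverses is
  chosen since \<open>inverse (v p)\<close> equals \<open>f / (f + 1)\<close> for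
  \<open>f = x p - 1\<close>, the shape that \<open>exists_subset_prod_less_succ\<close>
  expects.\<close>

lemma E_Un_left:
  assumes "S \<subseteq> P" "T \<subseteq> P" "W \<subseteq> P - S"
  shows "E (S \<union> W) T * (\<Prod>p\<in>W. inverse (v p)) \<le> E S T"
  unfolding E_eq sum_distrib_right
proof (rule sum_mono)
  fix i
  have "W \<subseteq> P" using assms by auto
  define c where "c = prod v (W \<inter> B i)"
  have "0 < c" unfolding c_def using \<open>W \<subseteq> P\<close> by (intro prod_v_pos) auto
  have "(\<Prod>p\<in>W. inverse (v p)) \<le> (\<Prod>p\<in>W \<inter> B i. inverse (v p))"
    using \<open>W \<subseteq> P\<close> v_pos v_inverse_le_1 by (intro prod_le_prod_Int) (auto intro: less_imp_le)
  also have "\<dots> = inverse c"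
    by (simp add: c_def prod_inversef[unfolded o_def])
  finally have "(\<Prod>p\<in>W. inverse (v p)) \<le> inverse c" .
  moreover have "0 \<le> prod u (T \<inter> B i) * prod v (S \<inter> B i) * c"
    using assms \<open>0 < c\<close> by (simp add: prod_u_Int_nonneg prod_v_Int_nonneg)
  ultimately have "prod u (T \<inter> B i) * prod v (S \<inter> B i) * c * (\<Prod>p\<in>W. inverse (v p))
      \<le> prod u (T \<inter> B i) * prod v (S \<inter> B i) * c * inverse c"
    by (rule mult_left_mono)
  moreover have "prod v ((S \<union> W) \<inter> B i) = prod v (S \<inter> B i) * c"
    unfolding c_def using assms by (intro prod_Un_Int)
  ultimately show "prod u (T \<inter> B i) * prod v ((S \<union> W) \<inter> B i) * (\<Prod>p\<in>W. inverse (v p))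
      \<le> prod u (T \<inter> B i) * prod v (S \<inter> B i)"
    using \<open>0 < c\<close> by (simp add: mult.assoc)
qed

lemma E_P_right_le:
  assumes "S \<subseteq> P"
  shows "E S P \<le> 1"
proof -
  have "E S P \<le> E P P"
    unfolding E_eq
  proof (intro sum_mono mult_left_mono)
    fix i
    show "prod v (S \<inter> B i) \<le> prod v (P \<inter> B i)"
      using assms finite_P by (intro prod_mono2) (auto intro: less_imp_le v_pos v_gt_1)
    show "0 \<le> prod u (P \<inter> B i)"
      by (simp add: prod_u_Int_nonneg)
  qed
  then show ?thesis by (simp add: balanced)
qed

text \<open>Completing \<open>S\<close> to \<open>P\<close> on both sides multiplies summands by
  factors \<open>u p * v p < 1\<close> and ends at the value 1, so the start must lie above
  it.\<close>

lemma E_diag_gt: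
  assumes "S \<subset> P"
  shows "1 < E S S"
proof -
  let ?w = "\<lambda>p. u p * v p"
  have w: "0 < ?w p" "?w p < 1" if "p \<in> P" for p
    using u_pos v_pos uv_less_1 that by auto
  have "prod ?w (P \<inter> B i) = prod ?w (S \<inter> B i) * prod ?w ((P - S) \<inter> B i)" for i
    using assms prod_Un_Int[of S "P - S" ?w "B i"] by (simp add: Un_absorb1 psubset_imp_subset)
  moreover have pos: "0 < prod ?w (S \<inter> B i)" for i
    using assms w(1) by (auto intro!: prod_pos)
  moreover have "prod ?w ((P - S) \<inter> B i) \<le> 1" for i
    using w by (intro prod_le_1) (auto intro: less_imp_le)
  ultimately have le: "prod ?w (P \<inter> B i) \<le> prod ?w (S \<inter> B i)" for i
    by (simp add: mult_left_le)
  \<comment> \<open>Strictness needs one summand that really contains a missing prime;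
    \<open>covered\<close> supplies it.\<close>
  obtain q i where q: "q \<in> P" "q \<notin> S" "i \<in> I" "q \<in> B i"
    using assms covered by blast
  have "prod ?w (P \<inter> B i) \<le> prod ?w (insert q (S \<inter> B i))"
  proof -
    have "(P \<inter> B i) \<inter> insert q S = insert q (S \<inter> B i)" using q assms by auto
    then show ?thesis
      using prod_le_prod_Int[of "P \<inter> B i" ?w "insert q S"] w by (simp add: less_imp_le)
  qed
  also have "\<dots> = ?w q * prod ?w (S \<inter> B i)"
    using q assms finite_sub[of S] by (intro prod.insert) auto
  also have "\<dots> < prod ?w (S \<inter> B i)"
    using w(2)[OF q(1)] pos[of i] by simp
  finally have "E P P < E S S"
    unfolding E_eq prod.distrib[symmetric] using le q(3) finite_I by (intro sum_strict_mono_ex1) auto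
  then show ?thesis by (simp add: balanced)
qed

lemma E_diag_ge: "T \<subseteq> P \<Longrightarrow> 1 \<le> E T T"
  using E_diag_gt[of T] balanced by (cases "T = P") (auto simp: psubset_eq)

section \<open>Integrality, the two extension steps and their iteration\<close>

lemma E_eq_fraction:
  assumes "S \<subseteq> P" "T \<subseteq> P"
  obtains C :: nat where "E S T = real C / real (D S T)"
proof
  \<comment> \<open>Inside \<open>B i\<close> the denominators cancel,
    \<open>u p * p = p - 1\<close> and \<open>v p * (x p - 1) = x p\<close>; outside
    \<open>B i\<close> the factors of \<open>D S T\<close> remain as they are.\<close>
  let ?C = "\<Sum>i\<in>I. (\<Prod>p\<in>T \<inter> B i. p - 1) * (\<Prod>p\<in>T - B i. p) * ((\<Prod>p\<in>S \<inter> B i. x p) * (\<Prod>p\<in>S - B i. x p - 1))"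
  have "E S T * real (D S T) = real ?C"
    unfolding E_eq sum_distrib_right of_nat_sum
  proof (rule sum.cong[OF refl])
    fix i
    have split: "prod f W * prod g W = (\<Prod>p\<in>W. f p * g p)" for f g :: "nat \<Rightarrow> real" and W
      by (simp add: prod.distrib)
    have T: "prod u (T \<inter> B i) * (\<Prod>p\<in>T. real p) = (\<Prod>p\<in>T \<inter> B i. real (p - 1)) * (\<Prod>p\<in>T - B i. real p)"
    proof -
      have "u p * real p = real (p - 1)" if "p \<in> T \<inter> B i" for p
        using that assms(2) ge_2[of p] by (auto simp: u_def left_diff_distrib of_nat_diff)
      then have "prod u (T \<inter> B i) * (\<Prod>p\<in>T \<inter> B i. real p) = (\<Prod>p\<in>T \<inter> B i. real (p - 1))"
        unfolding split by (rule prod.cong[OF refl])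
      moreover have "(\<Prod>p\<in>T. real p) = (\<Prod>p\<in>T \<inter> B i. real p) * (\<Prod>p\<in>T - B i. real p)"
        by (rule prod.Int_Diff[OF finite_sub[OF assms(2)]])
      ultimately show ?thesis by (metis mult.assoc)
    qed
    have S: "prod v (S \<inter> B i) * (\<Prod>p\<in>S. real (x p - 1))
        = (\<Prod>p\<in>S \<inter> B i. real (x p)) * (\<Prod>p\<in>S - B i. real (x p - 1))"
    proof -
      have "v p * real (x p - 1) = real (x p)" if "p \<in> S \<inter> B i" for p
        using that assms(1) x_pred[of p] unfolding v_def by fastforce
      then have "prod v (S \<inter> B i) * (\<Prod>p\<in>S \<inter> B i. real (x p - 1)) = (\<Prod>p\<in>S \<inter> B i. real (x p))"
        unfolding split by (rule prod.cong[OF refl])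
      moreover have "(\<Prod>p\<in>S. real (x p - 1)) = (\<Prod>p\<in>S \<inter> B i. real (x p - 1)) * (\<Prod>p\<in>S - B i. real (x p - 1))"
        by (rule prod.Int_Diff[OF finite_sub[OF assms(1)]])
      ultimately show ?thesis by (metis mult.assoc)
    qed
    have "prod u (T \<inter> B i) * prod v (S \<inter> B i) * real (D S T)
        = (prod u (T \<inter> B i) * (\<Prod>p\<in>T. real p)) * (prod v (S \<inter> B i) * (\<Prod>p\<in>S. real (x p - 1)))"
      by (simp only: D_def of_nat_mult of_nat_prod mult_ac)
    then show "prod u (T \<inter> B i) * prod v (S \<inter> B i) * real (D S T)
        = real ((\<Prod>p\<in>T \<inter> B i. p - 1) * (\<Prod>p\<in>T - B i. p) * ((\<Prod>p\<in>S \<inter> B i. x p) * (\<Prod>p\<in>S - B i. x p - 1)))"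
      unfolding T S by (simp only: of_nat_mult of_nat_prod)
  qed
  then show "E S T = real ?C / real (D S T)"
    using D_pos[OF assms] by (simp add: nonzero_eq_divide_eq)
qed

text \<open>With \<open>d = D S T\<close>, integrality gives \<open>E S T \<ge> (d + 1) / d\<close>,
  while \<open>E S P \<le> 1\<close>; so the missing \<open>1 - 1 / p\<close> multiply to at most
  \<open>1 - 1 / (d + 1)\<close>. Taking \<open>y = d + 1\<close> in
  \<open>exists_subset_prod_less_mult\<close> makes its factor \<open>y - 1\<close> equal to
  \<open>d\<close>, which merges with the new primes into the new denominator.\<close>

lemma extend_right:
  assumes "S \<subseteq> T" "T \<subseteq> P" "1 < E S T"
  obtains W where "W \<subseteq> P - T" "W \<noteq> {}" "D S (T \<union> W) + 1 \<le> (D S T + 1) ^ 2 ^ card W"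
proof -
  have "S \<subseteq> P" using assms by auto
  define d where "d = D S T"
  have "0 < d" unfolding d_def using D_pos \<open>S \<subseteq> P\<close> \<open>T \<subseteq> P\<close> by blast
  obtain C where C: "E S T = real C / real d"
    using E_eq_fraction[OF \<open>S \<subseteq> P\<close> \<open>T \<subseteq> P\<close>] unfolding d_def by blast
  with assms(3) \<open>0 < d\<close> have "d + 1 \<le> C" by simp
  have "E S T * prod u (P - T) \<le> E S (T \<union> (P - T))"
    using \<open>S \<subseteq> P\<close> assms(2) by (intro E_Un_right) auto
  also have "T \<union> (P - T) = P" using assms(2) by auto
  also have "E S P \<le> 1"
    by (rule E_P_right_le[OF \<open>S \<subseteq> P\<close>])
  finally have "prod u (P - T) \<le> 1 / E S T"
    using assms(3) by (simp add: pos_le_divide_eq mult.commute)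
  also have "\<dots> = real d / real C" by (simp add: C)
  also have "\<dots> \<le> real d / real (d + 1)"
    using \<open>d + 1 \<le> C\<close> \<open>0 < d\<close> by (intro divide_left_mono) auto
  also have "\<dots> = 1 - 1 / real (d + 1)" by (simp add: field_simps)
  finally have le: "(\<Prod>p\<in>P - T. 1 - 1 / real p) \<le> 1 - 1 / real (d + 1)"
    unfolding u_def .
  have "\<exists>W\<subseteq>P - T. W \<noteq> {} \<and> (real (d + 1) - 1) * (\<Prod>p\<in>W. real p) < real (d + 1) ^ 2 ^ card W"
  proof (rule exists_subset_prod_less_mult[OF _ _ _ le])
    show "1 < real p" if "p \<in> P - T" for p
      using that ge_2[of p] by simp
  qed (use finite_P \<open>0 < d\<close> in auto)
  then obtain W where W: "W \<subseteq> P - T" "W \<noteq> {}"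
      "(real (d + 1) - 1) * (\<Prod>p\<in>W. real p) < real (d + 1) ^ 2 ^ card W"
    by blast
  from W(3) have "real (d * (\<Prod>p\<in>W. p)) < real ((d + 1) ^ 2 ^ card W)"
    by (simp only: of_nat_mult of_nat_prod of_nat_power of_nat_add of_nat_1 add_diff_cancel_right')
  then have "D S (T \<union> W) < (d + 1) ^ 2 ^ card W"
    by (simp only: of_nat_less_iff D_Un_right[OF assms(2) W(1)] d_def)
  then show ?thesis
    using that W(1,2) unfolding d_def by (simp only: Suc_eq_plus1[symmetric] Suc_le_eq)
qed

text \<open>Here integrality gives \<open>E S T \<le> 1 - 1 / d\<close>, while
  \<open>E T T \<ge> 1\<close>; so the inverses of the missing \<open>v p\<close> multiply to at
  most \<open>1 - 1 / d\<close>. This product is positive, which forces \<open>1 < d\<close> and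
  permits \<open>y = d\<close> in \<open>exists_subset_prod_less_succ\<close>.\<close>

lemma extend_left:
  assumes "S \<subseteq> T" "T \<subseteq> P" "E S T < 1"
  obtains W where "W \<subseteq> T - S" "W \<noteq> {}" "(\<Prod>p\<in>W. x p - 1) < D S T ^ (2 ^ card W - 1)"
proof -
  have "S \<subseteq> P" using assms by auto
  define d where "d = D S T"
  have "0 < d" unfolding d_def using D_pos \<open>S \<subseteq> P\<close> \<open>T \<subseteq> P\<close> by blast
  obtain C where C: "E S T = real C / real d"
    using E_eq_fraction[OF \<open>S \<subseteq> P\<close> \<open>T \<subseteq> P\<close>] unfolding d_def by blast
  with assms(3) \<open>0 < d\<close> have "C + 1 \<le> d" by simp
  define Q where "Q = (\<Prod>p\<in>T - S. inverse (v p))"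
  have "0 < Q" unfolding Q_def using assms(2) v_pos by (auto intro!: prod_pos)
  then have "Q \<le> E T T * Q"
    using E_diag_ge[OF assms(2)] by simp
  also have "E T T * Q = E (S \<union> (T - S)) T * Q"
    using assms(1) by (simp add: Un_absorb1)
  also have "\<dots> \<le> E S T"
    unfolding Q_def using \<open>S \<subseteq> P\<close> assms(2) by (intro E_Un_left) auto
  also have "\<dots> \<le> real (d - 1) / real d"
    unfolding C using \<open>C + 1 \<le> d\<close> by (intro divide_right_mono) auto
  also have "\<dots> = 1 - 1 / real d" using \<open>0 < d\<close> by (simp add: field_simps)
  finally have Q: "Q \<le> 1 - 1 / real d" .
  with \<open>0 < Q\<close> have "1 / real d < 1" by linarith
  with \<open>0 < d\<close> have "1 < real d" by (simp add: divide_simps)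
  have "Q = (\<Prod>p\<in>T - S. real (x p - 1) / (real (x p - 1) + 1))"
    unfolding Q_def using assms(2) x_pred(1) by (intro prod.cong) (auto simp: v_def)
  with Q have le: "(\<Prod>p\<in>T - S. real (x p - 1) / (real (x p - 1) + 1)) \<le> 1 - 1 / real d"
    by (simp only:)
  have "\<exists>W\<subseteq>T - S. W \<noteq> {} \<and> (\<Prod>p\<in>W. real (x p - 1)) < real d ^ (2 ^ card W - 1)"
  proof (rule exists_subset_prod_less_succ[OF _ \<open>1 < real d\<close> _ le])
    show "0 < real (x p - 1)" if "p \<in> T - S" for p
      using that assms(2) x_pred(2)[of p] by (auto simp del: of_nat_diff)
    show "finite (T - S)"
      using assms(2) finite_sub by auto
  qed
  then obtain W where W: "W \<subseteq> T - S" "W \<noteq> {}" "(\<Prod>p\<in>W. real (x p - 1)) < real d ^ (2 ^ card W - 1)"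
    by blast
  from W(3) have "real (\<Prod>p\<in>W. x p - 1) < real (d ^ (2 ^ card W - 1))"
    by (simp only: of_nat_prod of_nat_power)
  then have "(\<Prod>p\<in>W. x p - 1) < d ^ (2 ^ card W - 1)"
    by (simp only: of_nat_less_iff)
  with that W show ?thesis unfolding d_def by blast
qed

text \<open>The bound is what results from adding all missing denominators in one run
  and then all missing powers in a second one; every other order does no better.\<close>

lemma ratio_less:
  assumes "S \<subseteq> T" "T \<subseteq> P" "S \<noteq> P"
  shows "real (\<Prod>p\<in>P. x p - 1) / real (\<Prod>p\<in>P. p)
    < real ((\<Prod>p\<in>S. x p - 1)\<^sup>2 * (D S T + 1) ^ (2 ^ card (P - T) * (2 ^ card (P - S) - 2)))"
  using assms
proof (induction "card (P - S) + card (P - T)" arbitrary: S T rule: less_induct)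
  case less
  have "S \<subset> P" and "S \<subseteq> P" using less.prems by auto
  \<comment> \<open>\<open>unbalanced\<close> covers proper inclusions only; on the diagonal the
    value exceeds 1.\<close>
  have "E S T \<noteq> 1"
    using unbalanced[of S T] E_diag_gt[OF \<open>S \<subset> P\<close>] less.prems by (cases "S = T") auto
  then consider "1 < E S T" | "E S T < 1" by linarith
  then show ?case
  proof cases
    case 1
    then obtain W where W: "W \<subseteq> P - T" "W \<noteq> {}" "D S (T \<union> W) + 1 \<le> (D S T + 1) ^ 2 ^ card W"
      using extend_right less.prems by metis
    have "finite W" using W(1) finite_P finite_subset by blast
    with W(2) have "0 < card W" by (simp add: card_gt_0_iff)
    have "P - T = (P - (T \<union> W)) \<union> W" using W(1) by auto
    then have card: "card (P - T) = card (P - (T \<union> W)) + card W"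
      using card_Un_disjoint[of "P - (T \<union> W)" W] \<open>finite W\<close> finite_P by auto
    let ?e = "2 ^ card (P - S) - 2 :: nat"
    have "real (\<Prod>p\<in>P. x p - 1) / real (\<Prod>p\<in>P. p)
        < real ((\<Prod>p\<in>S. x p - 1)\<^sup>2 * (D S (T \<union> W) + 1) ^ (2 ^ card (P - (T \<union> W)) * ?e))"
      using W(1) less.prems card \<open>0 < card W\<close> by (intro less.hyps) auto
    \<comment> \<open>The exponent of the induction hypothesis is smaller by the factor
      \<open>2 ^ card W\<close>, exactly the power lost in passing from
      \<open>D S (T \<union> W) + 1\<close> back to \<open>D S T + 1\<close>.\<close>
    also have "(D S (T \<union> W) + 1) ^ (2 ^ card (P - (T \<union> W)) * ?e)
        \<le> ((D S T + 1) ^ 2 ^ card W) ^ (2 ^ card (P - (T \<union> W)) * ?e)"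
      using W(3) by (intro power_mono) auto
    also have "\<dots> = (D S T + 1) ^ (2 ^ card (P - T) * ?e)"
      unfolding card by (simp only: power_mult[symmetric] power_add mult_ac)
    finally show ?thesis by (simp del: of_nat_mult of_nat_power)
  next
    case 2
    then obtain W where W: "W \<subseteq> T - S" "W \<noteq> {}" "(\<Prod>p\<in>W. x p - 1) < D S T ^ (2 ^ card W - 1)"
      using extend_left less.prems by metis
    define d X Y m where "d = D S T" and "X = (\<Prod>p\<in>S. x p - 1)" and "Y = (\<Prod>p\<in>W. x p - 1)"
      and "m = (2 ^ card W - 1 :: nat)"
    have "0 < d" unfolding d_def using less.prems by (intro D_pos) auto
    have Y: "Y < d ^ m" using W(3) by (simp add: d_def Y_def m_def)
    have "W \<subseteq> P - S" "finite W"
      using W(1) less.prems finite_sub[of W] by auto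
    with W(2) have "0 < card W" by (simp add: card_gt_0_iff)
    then have m: "2 ^ card W = m + 1" "1 \<le> m"
      using one_less_power[of "2 :: nat" "card W"] by (auto simp: m_def)
    have "P - S = (P - (S \<union> W)) \<union> W" using \<open>W \<subseteq> P - S\<close> by auto
    then have card: "card (P - S) = card (P - (S \<union> W)) + card W"
      using card_Un_disjoint[of "P - (S \<union> W)" W] \<open>finite W\<close> finite_P by auto
    have XY: "(\<Prod>p\<in>S \<union> W. x p - 1) = X * Y"
      using D_Un_left[OF \<open>S \<subseteq> P\<close> \<open>W \<subseteq> P - S\<close>, of "{}"] by (simp add: D_def X_def Y_def)
    have dY: "D (S \<union> W) T = d * Y"
      using D_Un_left[OF \<open>S \<subseteq> P\<close> \<open>W \<subseteq> P - S\<close>, of T] by (simp add: d_def Y_def)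
    show ?thesis
    proof (cases "S \<union> W = P")
      \<comment> \<open>The induction hypothesis excludes \<open>S = P\<close>, so the last step is
        done directly. Now \<open>T = P\<close>, and dividing by the product of all primes is
        multiplying by \<open>X / d\<close>: this is the origin of the square of \<open>X\<close> in
        the bound.\<close>
      case True
      then have "T = P" using W(1) less.prems by auto
      have "0 < X" "0 < real (\<Prod>p\<in>P. p)"
        using D_pos[OF \<open>S \<subseteq> P\<close>, of P] by (auto simp: D_def X_def simp del: of_nat_prod)
      have d: "real d = real X * real (\<Prod>p\<in>P. p)"
        by (simp only: d_def D_def \<open>T = P\<close> X_def of_nat_mult mult.commute)
      have "real (\<Prod>p\<in>P. x p - 1) / real (\<Prod>p\<in>P. p) = real X * real Y / real (\<Prod>p\<in>P. p)"
        using XY True by (simp only: of_nat_mult)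
      also have "\<dots> = real (X\<^sup>2) * (real Y / real d)"
        unfolding d using \<open>0 < X\<close> by (simp add: power2_eq_square)
      also have "\<dots> < real (X\<^sup>2) * real (d ^ (m - 1))"
      proof (rule mult_strict_left_mono)
        have "Y < d ^ (m - 1) * d"
          using Y m(2) power_minus_mult[of m d] by simp
        then have "real Y < real (d ^ (m - 1)) * real d"
          by (simp only: of_nat_mult[symmetric] of_nat_less_iff)
        with \<open>0 < d\<close> show "real Y / real d < real (d ^ (m - 1))"
          by (simp add: pos_divide_less_eq)
      qed (use \<open>0 < X\<close> in simp)
      also have "\<dots> \<le> real (X\<^sup>2 * (d + 1) ^ (m - 1))"
        unfolding of_nat_mult[symmetric] of_nat_le_iff by (intro mult_left_mono power_mono) auto
      also have "m - 1 = 2 ^ card (P - T) * (2 ^ card (P - S) - 2)"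
        unfolding card True \<open>T = P\<close> using m by simp
      finally show ?thesis by (simp only: d_def X_def)
    next
      case False
      define a where "a = (2 ^ card (P - T) :: nat)"
      have "1 \<le> a" by (simp add: a_def)
      have "P - (S \<union> W) \<noteq> {}" using False less.prems W(1) by auto
      then have "0 < card (P - (S \<union> W))" using finite_P by (simp add: card_gt_0_iff)
      then have two_le: "2 ^ 1 \<le> (2 :: nat) ^ card (P - (S \<union> W))" by (intro power_increasing) auto
      define n where "n = (2 ^ card (P - (S \<union> W)) - 2 :: nat)"
      have n: "2 ^ card (P - (S \<union> W)) = n + 2"
        unfolding n_def by (rule le_add_diff_inverse2[symmetric]) (use two_le in simp)
      have "real (\<Prod>p\<in>P. x p - 1) / real (\<Prod>p\<in>P. p)
          < real ((\<Prod>p\<in>S \<union> W. x p - 1)\<^sup>2 * (D (S \<union> W) T + 1) ^ (2 ^ card (P - T) * (2 ^ card (P - (S \<union> W)) - 2)))"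
        using W(1) less.prems False card \<open>0 < card W\<close> by (intro less.hyps) auto
      also have "\<dots> = real ((X * Y)\<^sup>2 * (d * Y + 1) ^ (a * n))"
        by (simp only: XY dY a_def n_def)
      finally have *: "real (\<Prod>p\<in>P. x p - 1) / real (\<Prod>p\<in>P. p) < \<dots>" .
      have "d * Y < d * d ^ m"
        using Y \<open>0 < d\<close> by (rule mult_strict_left_mono)
      then have "d * Y + 1 \<le> d ^ (m + 1)"
        by (simp only: Suc_eq_plus1[symmetric] Suc_le_eq power_Suc)
      have "(X * Y)\<^sup>2 * (d * Y + 1) ^ (a * n) \<le> X\<^sup>2 * ((d ^ m)\<^sup>2 * (d ^ (m + 1)) ^ (a * n))"
        unfolding power_mult_distrib mult.assoc
        using Y \<open>d * Y + 1 \<le> d ^ (m + 1)\<close> by (intro mult_mono power_mono order_refl) auto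
      also have "(d ^ m)\<^sup>2 * (d ^ (m + 1)) ^ (a * n) = d ^ (m * 2 + (m + 1) * (a * n))"
        by (simp only: power_mult[symmetric] power_add[symmetric])
      also have "X\<^sup>2 * d ^ (m * 2 + (m + 1) * (a * n)) \<le> X\<^sup>2 * (d + 1) ^ (a * (n * m + n + 2 * m))"
      proof (rule mult_left_mono)
        \<comment> \<open>The part \<open>(m + 1) * (a * n)\<close> occurs on both sides; the
          \<open>2 * m\<close> from squaring \<open>Y\<close> is absorbed because
          \<open>1 \<le> a\<close>.\<close>
        have "m * 2 + (m + 1) * (a * n) \<le> a * (n * m + n + 2 * m)"
          using \<open>1 \<le> a\<close> by (simp add: algebra_simps)
        then have "d ^ (m * 2 + (m + 1) * (a * n)) \<le> d ^ (a * (n * m + n + 2 * m))"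
          using \<open>0 < d\<close> by (intro power_increasing) auto
        also have "\<dots> \<le> (d + 1) ^ (a * (n * m + n + 2 * m))"
          by (intro power_mono) auto
        finally show "d ^ (m * 2 + (m + 1) * (a * n)) \<le> (d + 1) ^ (a * (n * m + n + 2 * m))" .
      qed simp
      \<comment> \<open>Expansion of \<open>(n + 2) * (m + 1) - 2\<close>.\<close>
      also have "n * m + n + 2 * m = 2 ^ card (P - S) - 2"
        unfolding card power_add n m(1) by (simp add: algebra_simps)
      finally have "(X * Y)\<^sup>2 * (d * Y + 1) ^ (a * n) \<le> X\<^sup>2 * (d + 1) ^ (a * (2 ^ card (P - S) - 2))" .
      then have "real ((X * Y)\<^sup>2 * (d * Y + 1) ^ (a * n)) \<le> real (X\<^sup>2 * (d + 1) ^ (a * (2 ^ card (P - S) - 2)))"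
        by (simp only: of_nat_le_iff)
      with * show ?thesis by (simp only: d_def X_def a_def)
    qed
  qed
qed

text \<open>For empty \<open>S\<close> and \<open>T\<close> the denominator \<open>D\<close> is 1,
  whence the base \<open>1 + 1 = 2\<close>.\<close>

corollary ratio_less_two_power:
  assumes "P \<noteq> {}"
  shows "real (\<Prod>p\<in>P. x p - 1) / real (\<Prod>p\<in>P. p) < 2 ^ (2 ^ card P * (2 ^ card P - 2))"
  using ratio_less[of "{}" "{}"] assms by (simp add: D_def)

end

subsection \<open>Anarchy harmonious tuples\<close>

text \<open>Exactly one fraction has \<open>q\<close> in its denominator and none in its numerator.
  After clearing denominators \<open>q\<close> divides every term except \<open>n i\<close> times
  the other denominators.\<close>

lemma sum_fractions_neq_1:
  fixes n m :: "'a \<Rightarrow> nat" and q :: nat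
  assumes "finite I" "i \<in> I" "prime q" "\<And>j. j \<in> I \<Longrightarrow> 0 < m j"
    and "q dvd m i" "\<not> q dvd n i" "\<And>j. j \<in> I \<Longrightarrow> j \<noteq> i \<Longrightarrow> \<not> q dvd m j"
  shows "(\<Sum>j\<in>I. real (n j) / real (m j)) \<noteq> 1"
proof
  assume eq: "(\<Sum>j\<in>I. real (n j) / real (m j)) = 1"
  have common: "\<exists>z. (\<Sum>j\<in>J. real (n j) / real (m j)) = real z / real (prod m J)"
    if "finite J" "J \<subseteq> I" for J
    using that
  proof (induction J rule: finite_induct)
    case (insert j J)
    then obtain z where "(\<Sum>j\<in>J. real (n j) / real (m j)) = real z / real (prod m J)"
      by auto
    moreover have "0 < m j" "0 < prod m J"
      using insert assms(4) by (auto intro!: prod_pos)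
    ultimately have "(\<Sum>j\<in>insert j J. real (n j) / real (m j))
        = real (n j * prod m J + z * m j) / real (prod m (insert j J))"
      using insert.hyps by (simp add: add_frac_eq del: of_nat_prod)
    then show ?case by blast
  qed (auto intro: exI[of _ 0])
  define m' where "m' = prod m (I - {i})"
  obtain z where z: "(\<Sum>j\<in>I - {i}. real (n j) / real (m j)) = real z / real m'"
    using common[of "I - {i}"] assms(1) unfolding m'_def by auto
  have pos: "0 < m i" "0 < m'"
    unfolding m'_def using assms(2,4) by (blast, intro prod_pos, blast)
  have "real (n i) / real (m i) + real z / real m' = 1"
    using eq assms(1,2) by (simp only: sum.remove z)
  with pos have "real (n i * m' + z * m i) = real (m i * m')"
    by (simp add: add_frac_eq divide_eq_1_iff)
  then have "n i * m' + z * m i = m i * m'"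
    by (simp only: of_nat_eq_iff)
  then have "q dvd n i * m'"
    using assms(5) by (metis dvd_add_left_iff dvd_mult dvd_mult2)
  then show False
    unfolding m'_def using assms(1,3,6,7) by (auto simp: prime_dvd_mult_iff prime_dvd_prod_iff)
qed

lemma prime_factor_gt_1: "p \<in> prime_factors n \<Longrightarrow> 1 < (p :: nat)"
  by (rule prime_gt_1_nat) (rule in_prime_factors_imp_prime)

locale anarchy_harmonious =
  fixes k :: nat and M :: "nat \<Rightarrow> nat"
  assumes anarchy: "anarchy k M" and harmonious: "harmonious k M"
begin

definition N :: nat where "N = (\<Prod>i=1..k. M i)"

text \<open>Taking the exponent in \<open>N\<close> makes \<open>x\<close> depend on the prime
  alone; by \<open>multiplicity_N\<close> it is also the exponent in the single entry that contains
  \<open>p\<close>.\<close>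

definition x :: "nat \<Rightarrow> nat" where "x p = p ^ Suc (multiplicity p N)"

abbreviation B :: "nat \<Rightarrow> nat set" where "B i \<equiv> prime_factors (M i)"

lemma M_pos: "i \<in> {1..k} \<Longrightarrow> 0 < M i"
  using anarchy by (simp add: anarchy_def)

lemma coprime_M: "i \<in> {1..k} \<Longrightarrow> j \<in> {1..k} \<Longrightarrow> i \<noteq> j \<Longrightarrow> coprime (M i) (M j * sigma (M j))"
  using anarchy by (simp add: anarchy_def coprime_iff_gcd_eq_1)

lemma N_pos: "0 < N"
  unfolding N_def using M_pos by (intro prod_pos) auto

lemma prime_factors_N: "prime_factors N = (\<Union>i\<in>{1..k}. B i)"
  unfolding N_def using M_pos by (subst prime_factors_prod) fastforce+

lemma not_dvd_other:
  assumes "i \<in> {1..k}" "j \<in> {1..k}" "i \<noteq> j" "p \<in> B i"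
  shows "\<not> p dvd M j" "\<not> p dvd sigma (M j)"
proof -
  have "prime p" "p dvd M i" using assms(4) by auto
  then have "\<not> p dvd M j * sigma (M j)"
    using coprime_M[OF assms(1-3)] by (meson coprime_common_divisor not_prime_unit)
  then show "\<not> p dvd M j" "\<not> p dvd sigma (M j)"
    using dvd_mult dvd_mult2 by blast+
qed

lemma multiplicity_N:
  assumes "i \<in> {1..k}" "p \<in> B i"
  shows "multiplicity p N = multiplicity p (M i)"
proof -
  have "multiplicity p N = (\<Sum>j=1..k. multiplicity p (M j))"
    unfolding N_def
  proof (rule prime_elem_multiplicity_prod_distrib)
    show "prime_elem p" using assms(2) by auto
    show "0 \<notin> M ` {1..k}" using M_pos by (metis imageE less_irrefl)
  qed simp
  also have "\<dots> = multiplicity p (M i) + (\<Sum>j\<in>{1..k} - {i}. multiplicity p (M j))"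
    using assms by (intro sum.remove) auto
  also have "(\<Sum>j\<in>{1..k} - {i}. multiplicity p (M j)) = 0"
    using not_dvd_other(1)[OF assms(1) _ _ assms(2)]
    by (intro sum.neutral) (auto intro!: not_dvd_imp_multiplicity_0)
  finally show ?thesis by simp
qed

lemma M_over_sigma:
  assumes "i \<in> {1..k}"
  shows "real (M i) / real (sigma (M i))
    = (\<Prod>p\<in>B i. 1 - 1 / real p) * (\<Prod>p\<in>B i. real (x p) / (real (x p) - 1))"
proof -
  let ?e = "\<lambda>p. multiplicity p (M i)"
  have "real (M i) / real (sigma (M i))
      = real (\<Prod>p\<in>B i. p ^ ?e p) / real (\<Prod>p\<in>B i. \<Sum>l\<le>?e p. p ^ l)"
    using M_pos[OF assms] by (simp only: sigma_eq_prod prime_factorization_nat[symmetric])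
  also have "\<dots> = (\<Prod>p\<in>B i. real p ^ ?e p / (\<Sum>l\<le>?e p. real p ^ l))"
    by (simp add: prod_dividef)
  also have "\<dots> = (\<Prod>p\<in>B i. (1 - 1 / real p) * (real (x p) / (real (x p) - 1)))"
  proof (rule prod.cong[OF refl])
    fix p assume p: "p \<in> B i"
    then have "1 < p" using prime_factor_gt_1 by blast
    then have "real p ^ ?e p / (\<Sum>l\<le>?e p. real p ^ l)
        = (1 - 1 / real p) * (real p ^ Suc (?e p) / (real p ^ Suc (?e p) - 1))"
      by (intro power_over_geometric_sum) auto
    then show "real p ^ ?e p / (\<Sum>l\<le>?e p. real p ^ l) = (1 - 1 / real p) * (real (x p) / (real (x p) - 1))"
      by (simp only: x_def multiplicity_N[OF assms p] of_nat_power)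
  qed
  finally show ?thesis by (simp only: prod.distrib)
qed

lemma partial_value_N: "partial_value x {1..k} B (prime_factors N) (prime_factors N) = 1"
proof -
  have "prime_factors N \<inter> B i = B i" if "i \<in> {1..k}" for i
    using that prime_factors_N by blast
  then have "partial_value x {1..k} B (prime_factors N) (prime_factors N)
      = (\<Sum>i=1..k. real (M i) / real (sigma (M i)))"
    unfolding partial_value_def by (intro sum.cong refl) (simp add: M_over_sigma)
  then show ?thesis using harmonious by (simp add: harmonious_def)
qed

text \<open>Primes in \<open>S\<close> contribute the whole fraction
  \<open>p ^ e / sigma (p ^ e)\<close>, those in \<open>T - S\<close> only
  \<open>(p - 1) / p\<close>. A suitable prime of \<open>T - S\<close> then occurs in the
  denominator of one summand without any chance of cancelling.\<close>

lemma partial_value_neq_1: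
  assumes "S \<subset> T" "T \<subseteq> prime_factors N"
  shows "partial_value x {1..k} B S T \<noteq> 1"
proof -
  let ?e = "\<lambda>p. multiplicity p N"
  let ?s = "\<lambda>p. \<Sum>l\<le>?e p. p ^ l"
  define n where "n i = (\<Prod>p\<in>S \<inter> B i. p ^ ?e p) * (\<Prod>p\<in>(T - S) \<inter> B i. p - 1)" for i
  define m where "m i = (\<Prod>p\<in>S \<inter> B i. ?s p) * (\<Prod>p\<in>(T - S) \<inter> B i. p)" for i
  have fin: "finite S" "finite T"
    using assms finite_subset[of _ "prime_factors N"] by (auto dest!: psubset_imp_subset)
  have prime: "prime p" if "p \<in> T" for p
    using that assms(2) by auto
  have s_pos: "0 < ?s p" for p
    by (rule sum_pos2[of _ 0]) auto
  have "partial_value x {1..k} B S T = (\<Sum>i=1..k. real (n i) / real (m i))"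
    unfolding partial_value_def
  proof (rule sum.cong[OF refl])
    fix i
    have "T \<inter> B i = (S \<inter> B i) \<union> ((T - S) \<inter> B i)" using assms by auto
    then have "(\<Prod>p\<in>T \<inter> B i. 1 - 1 / real p) * (\<Prod>p\<in>S \<inter> B i. real (x p) / (real (x p) - 1))
        = ((\<Prod>p\<in>S \<inter> B i. 1 - 1 / real p) * (\<Prod>p\<in>(T - S) \<inter> B i. 1 - 1 / real p))
          * (\<Prod>p\<in>S \<inter> B i. real (x p) / (real (x p) - 1))"
      using fin by (subst \<open>T \<inter> B i = _\<close>, subst prod.union_disjoint) auto
    also have "\<dots> = (\<Prod>p\<in>S \<inter> B i. (1 - 1 / real p) * (real (x p) / (real (x p) - 1)))
        * (\<Prod>p\<in>(T - S) \<inter> B i. 1 - 1 / real p)"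
      by (simp only: prod.distrib mult_ac)
    also have "(\<Prod>p\<in>S \<inter> B i. (1 - 1 / real p) * (real (x p) / (real (x p) - 1)))
        = (\<Prod>p\<in>S \<inter> B i. real (p ^ ?e p) / real (?s p))"
    proof (rule prod.cong[OF refl])
      fix p assume "p \<in> S \<inter> B i"
      then have "1 < p" using prime_factor_gt_1 by blast
      then show "(1 - 1 / real p) * (real (x p) / (real (x p) - 1)) = real (p ^ ?e p) / real (?s p)"
        using power_over_geometric_sum[of "real p" "?e p"] by (simp add: x_def)
    qed
    also have "(\<Prod>p\<in>(T - S) \<inter> B i. 1 - 1 / real p) = (\<Prod>p\<in>(T - S) \<inter> B i. real (p - 1) / real p)"
    proof (rule prod.cong[OF refl])
      fix p assume "p \<in> (T - S) \<inter> B i"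
      then have "1 < p" using prime_factor_gt_1 by blast
      then show "1 - 1 / real p = real (p - 1) / real p" by (simp add: field_simps)
    qed
    also have "(\<Prod>p\<in>S \<inter> B i. real (p ^ ?e p) / real (?s p)) * \<dots> = real (n i) / real (m i)"
      by (simp only: n_def m_def of_nat_mult of_nat_prod prod_dividef times_divide_times_eq)
    finally show "(\<Prod>p\<in>T \<inter> B i. 1 - 1 / real p) * (\<Prod>p\<in>S \<inter> B i. real (x p) / (real (x p) - 1))
        = real (n i) / real (m i)" .
  qed
  also have "\<dots> \<noteq> 1"
  proof -
    \<comment> \<open>Maximality ensures that \<open>q\<close> divides no \<open>p - 1\<close> with
      \<open>p\<close> in \<open>T - S\<close>.\<close>
    define q where "q = Max (T - S)"
    have q: "q \<in> T - S" and q_max: "p \<le> q" if "p \<in> T - S" for p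
      using fin assms Max_in[of "T - S"] that unfolding q_def by auto
    have "q \<in> T - S" using q assms by blast
    then have "prime q" using prime by auto
    obtain i where i: "i \<in> {1..k}" "q \<in> B i"
      using \<open>q \<in> T - S\<close> assms(2) prime_factors_N by blast
    show ?thesis
    proof (rule sum_fractions_neq_1[OF _ i(1) \<open>prime q\<close>])
      show "0 < m j" for j
        unfolding m_def using s_pos prime by (intro mult_pos_pos prod_pos) (auto simp: prime_gt_0_nat)
      show "q dvd m i"
        unfolding m_def using fin \<open>q \<in> T - S\<close> i by (intro dvd_mult dvd_prodI) auto
      show "\<not> q dvd n i"
      proof
        assume "q dvd n i"
        then consider "q dvd (\<Prod>p\<in>S \<inter> B i. p ^ ?e p)" | "q dvd (\<Prod>p\<in>(T - S) \<inter> B i. p - 1)"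
          unfolding n_def using \<open>prime q\<close> prime_dvd_mult_iff by blast
        then show False
        proof cases
          case 1
          then obtain p where "p \<in> S" "q dvd p ^ ?e p"
            using fin \<open>prime q\<close> by (auto simp: prime_dvd_prod_iff)
          then have "q = p"
            using \<open>prime q\<close> prime[of p] assms(1) by (auto dest: prime_dvd_power intro: primes_dvd_imp_eq)
          then show False using \<open>p \<in> S\<close> \<open>q \<in> T - S\<close> by simp
        next
          case 2
          then obtain p where p: "p \<in> T - S" "q dvd p - 1"
            using fin \<open>prime q\<close> by (auto simp: prime_dvd_prod_iff)
          moreover have "1 < p" using p prime prime_gt_1_nat by blast
          ultimately have "q \<le> p - 1" by (intro dvd_imp_le) auto
          with q_max[OF p(1)] \<open>1 < p\<close> show False by simp
        qed
      qed
      \<comment> \<open>The denominator of another summand consists of divisors of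
        \<open>sigma (M j)\<close> and primes of \<open>M j\<close>; anarchy keeps \<open>q\<close>
        away from both.\<close>
      show "\<not> q dvd m j" if j: "j \<in> {1..k}" "j \<noteq> i" for j
      proof
        assume "q dvd m j"
        then consider p where "p \<in> S \<inter> B j" "q dvd ?s p" | p where "p \<in> (T - S) \<inter> B j" "q dvd p"
          unfolding m_def using \<open>prime q\<close> fin by (auto simp: prime_dvd_mult_iff prime_dvd_prod_iff)
        then show False
        proof cases
          case 1
          then have "?s p = (\<Sum>l\<le>multiplicity p (M j). p ^ l)"
            using multiplicity_N[OF j(1)] by simp
          also have "\<dots> dvd sigma (M j)"
            unfolding sigma_eq_prod[OF M_pos[OF j(1)]] using 1 by (intro dvd_prodI) auto
          finally have "q dvd sigma (M j)" using 1 dvd_trans by blast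
          then show False using not_dvd_other(2)[OF i(1) j(1) _ i(2)] j(2) by auto
        next
          case 2
          then have "q dvd M j" using dvd_trans by auto
          then show False using not_dvd_other(1)[OF i(1) j(1) _ i(2)] j(2) by auto
        qed
      qed
    qed simp
  qed
  finally show ?thesis .
qed

sublocale balanced_products "prime_factors N" x "{1..k}" B
proof
  fix p assume "p \<in> prime_factors N"
  then have p: "1 < p" "1 \<le> multiplicity p N"
    by (rule prime_factor_gt_1) (use \<open>p \<in> prime_factors N\<close> in \<open>simp add: prime_factors_multiplicity Suc_le_eq\<close>)
  then show "2 \<le> p" by simp
  have "p ^ 1 < p ^ Suc (multiplicity p N)"
    using p by (intro power_strict_increasing) auto
  then show "p < x p" by (simp add: x_def)
qed (use partial_value_N partial_value_neq_1 prime_factors_N in auto)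

section \<open>From the ratio to the product of the tuple\<close>

lemma N_less:
  assumes "2 \<le> k"
  defines "K \<equiv> omega N"
  shows "0 < K" "real N < pi\<^sup>2 / 6 * 2 ^ (2 ^ K * (2 ^ K - 2))"
proof -
  let ?P = "prime_factors N"
  \<comment> \<open>Without primes every summand is 1 and the sum is \<open>k\<close>, contrary to
    \<open>2 \<le> k\<close>.\<close>
  have "?P \<noteq> {}"
  proof
    assume "?P = {}"
    then have "real k = 1" using partial_value_N by (simp add: partial_value_def)
    with assms show False by simp
  qed
  then show "0 < K" by (simp add: K_def omega_def card_gt_0_iff)
  have R: "0 < (\<Prod>p\<in>?P. real p)"
    using prime_factor_gt_1 by (intro prod_pos) fastforce
  have "real N = real (\<Prod>p\<in>?P. p ^ multiplicity p N)"
    using N_pos by (simp only: prime_factorization_nat[symmetric])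
  \<comment> \<open>Each \<open>x p\<close> carries one factor \<open>p\<close> more than
    \<open>N\<close> does.\<close>
  then have "real N * (\<Prod>p\<in>?P. real p) = (\<Prod>p\<in>?P. real (x p))"
    by (simp add: x_def prod.distrib mult.commute)
  then have N: "real N = (\<Prod>p\<in>?P. real (x p)) / (\<Prod>p\<in>?P. real p)"
    using R by (simp add: nonzero_eq_divide_eq)
  have "(\<Prod>p\<in>?P. real (x p)) * (6 / pi\<^sup>2) \<le> (\<Prod>p\<in>?P. real (x p)) * (\<Prod>p\<in>?P. 1 - 1 / (real p)\<^sup>2)"
    by (intro mult_left_mono prod_one_minus_inverse_squares_ge) (auto intro: prod_nonneg)
  also have "\<dots> = (\<Prod>p\<in>?P. real (x p) * (1 - 1 / (real p)\<^sup>2))"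
    by (simp add: prod.distrib)
  \<comment> \<open>Every prime of \<open>N\<close> has exponent at least 1, so
    \<open>x p \<ge> p ^ 2\<close> and \<open>x p / p ^ 2\<close> is at least the 1 subtracted on
    the right.\<close>
  also have "\<dots> \<le> (\<Prod>p\<in>?P. real (x p - 1))"
  proof (rule prod_mono, intro conjI)
    fix p assume "p \<in> ?P"
    then have p: "1 < p" "1 \<le> multiplicity p N"
      by (rule prime_factor_gt_1) (use \<open>p \<in> ?P\<close> in \<open>simp add: prime_factors_multiplicity Suc_le_eq\<close>)
    then have "real p ^ 2 \<le> real p ^ Suc (multiplicity p N)"
      by (intro power_increasing) auto
    then have "(real p)\<^sup>2 \<le> real (x p)" by (simp add: x_def)
    then have "1 \<le> real (x p) / (real p)\<^sup>2" using p by simp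
    moreover have "real (x p - 1) = real (x p) - 1"
      using x_pred(1) \<open>p \<in> ?P\<close> by blast
    ultimately show "real (x p) * (1 - 1 / (real p)\<^sup>2) \<le> real (x p - 1)"
      by (simp add: right_diff_distrib)
    have "1 / (real p)\<^sup>2 \<le> 1" using p by simp
    then show "0 \<le> real (x p) * (1 - 1 / (real p)\<^sup>2)" by (intro mult_nonneg_nonneg) auto
  qed
  finally have "(\<Prod>p\<in>?P. real (x p)) \<le> pi\<^sup>2 / 6 * (\<Prod>p\<in>?P. real (x p - 1))"
    by (simp add: field_simps)
  then have "real N \<le> pi\<^sup>2 / 6 * (\<Prod>p\<in>?P. real (x p - 1)) / (\<Prod>p\<in>?P. real p)"
    unfolding N using R by (intro divide_right_mono) auto
  also have "\<dots> = pi\<^sup>2 / 6 * (real (\<Prod>p\<in>?P. x p - 1) / real (\<Prod>p\<in>?P. p))"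
    by (simp only: of_nat_prod times_divide_eq_right)
  also have "\<dots> < pi\<^sup>2 / 6 * 2 ^ (2 ^ K * (2 ^ K - 2))"
    unfolding K_def omega_def using ratio_less_two_power[OF \<open>?P \<noteq> {}\<close>]
    by (intro mult_strict_left_mono) auto
  finally show "real N < pi\<^sup>2 / 6 * 2 ^ (2 ^ K * (2 ^ K - 2))" .
qed

end

theorem theorem1:
  fixes k K :: nat and M :: "nat \<Rightarrow> nat"
  assumes "k \<ge> 2"
    and "anarchy k M"
    and "harmonious k M"
    and "K = omega (\<Prod>i=1..k. M i)"
  shows "real (\<Prod>i=1..k. M i) < pi ^ 2 / 6 * 2 powr (4 ^ K - 2 * 2 ^ K)"
proof -
  interpret anarchy_harmonious k M
    using assms by unfold_locales
  have K: "K = omega N" using assms(4) by (simp add: N_def)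
  \<comment> \<open>\<open>K\<close> is positive, so the subtraction \<open>2 ^ K - 2\<close> on
    natural numbers is not truncated.\<close>
  have "2 ^ 1 \<le> (2 :: nat) ^ K"
    using N_less(1)[OF assms(1)] unfolding K by (intro power_increasing) auto
  then have "real (2 ^ K * (2 ^ K - 2)) = 2 ^ K * (2 ^ K - 2)"
    by (simp add: of_nat_diff)
  also have "\<dots> = (4 :: real) ^ K - 2 * 2 ^ K"
    by (simp add: algebra_simps flip: power_mult_distrib)
  finally have "2 ^ (2 ^ K * (2 ^ K - 2)) = (2 :: real) powr (4 ^ K - 2 * 2 ^ K)"
    by (metis powr_realpow zero_less_numeral)
  then show ?thesis
    using N_less(2)[OF assms(1)] unfolding K[symmetric] by (simp only: N_def)
qed

end
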